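(* Let $G$ be a vertex-transitive graph. Then $fix_f(G)=\frac{|V(G)|}{f(G)}$.
   Context: All graphs are finite, simple, undirected and non-trivial (at least two vertices). A graph is vertex-transitive if its automorphism group acts transitively on its vertex set. Let $\Gamma=\Gamma(G)$ be the automorphism group of $G$. For $u\in V(G)$, $O(u)$ is the $\Gamma$-orbit of $u$; for $x\in V(G)$, $\Gamma_x$ is the stabilizer of $x$ and $O_x(u)=\{\pi(u):\pi\in\Gamma_x\}$. Let $V_a(G)=\{(u,v): u\neq v,\ O(u)=O(v)\}$. For vertices $u,v$ let $F(u,v)=\{x\in V(G):O_x(u)\neq O_x(v)\}$. Let $f(G)=\min\{|F(u,v)|:(u,v)\in V_a(G)\}$. A function $g:V(G)\to[0,1]$ is a fixing function of $G$ if $\sum_{x\in F(u,v)}g(x)\ge 1$ for every $(u,v)\in V_a(G)$. Put $|g|=\sum_{x\in V(G)}g(x)$. The fractional fixing number $fix_f(G)$ is the minimum of $|g|$ over all fixing functions $g$ of $G$. *)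

theory Defs
  imports "HOL-Analysis.Function_Topology" "HOL-Combinatorics.Permutations"
    "Graph_Theory.Pair_Digraph"
begin

text \<open>
  A finite simple undirected graph is a \<^locale>\<open>pair_graph\<close>: a finite vertex set
  \<^const>\<open>pverts\<close> with a symmetric, loop-free set of ordered pairs \<^const>\<open>parcs\<close>,
  each edge being represented by both of its orientations.
\<close>

text \<open>
  The predicate \<open>permutes\<close> makes an automorphism the identity outside the vertex set.
\<close>

definition automorphisms :: "'a pair_pre_digraph \<Rightarrow> ('a \<Rightarrow> 'a) set" where
  "automorphisms G = {\<pi>. \<pi> permutes pverts G \<and>
     (\<forall>u\<in>pverts G. \<forall>v\<in>pverts G. (u, v) \<in> parcs G \<longleftrightarrow> (\<pi> u, \<pi> v) \<in> parcs G)}"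

definition vertex_transitive :: "'a pair_pre_digraph \<Rightarrow> bool" where
  "vertex_transitive G \<longleftrightarrow>
     (\<forall>u\<in>pverts G. \<forall>v\<in>pverts G. \<exists>\<pi>\<in>automorphisms G. \<pi> u = v)"

definition aut_orbit :: "'a pair_pre_digraph \<Rightarrow> 'a \<Rightarrow> 'a set" where
  "aut_orbit G u = {\<pi> u | \<pi>. \<pi> \<in> automorphisms G}"

definition aut_stabilizer :: "'a pair_pre_digraph \<Rightarrow> 'a \<Rightarrow> ('a \<Rightarrow> 'a) set" where
  "aut_stabilizer G x = {\<pi> \<in> automorphisms G. \<pi> x = x}"

definition stab_orbit :: "'a pair_pre_digraph \<Rightarrow> 'a \<Rightarrow> 'a \<Rightarrow> 'a set" where
  "stab_orbit G x u = {\<pi> u | \<pi>. \<pi> \<in> aut_stabilizer G x}"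

definition V_a :: "'a pair_pre_digraph \<Rightarrow> ('a \<times> 'a) set" where
  "V_a G = {(u, v). u \<in> pverts G \<and> v \<in> pverts G \<and> u \<noteq> v \<and> aut_orbit G u = aut_orbit G v}"

definition fixing_set :: "'a pair_pre_digraph \<Rightarrow> 'a \<Rightarrow> 'a \<Rightarrow> 'a set" where
  "fixing_set G u v = {x \<in> pverts G. stab_orbit G x u \<noteq> stab_orbit G x v}"

text \<open>Unspecified when \<open>V_a G\<close> is empty.\<close>

definition min_fixing_card :: "'a pair_pre_digraph \<Rightarrow> nat" where
  "min_fixing_card G = Min {card (fixing_set G u v) | u v. (u, v) \<in> V_a G}"

definition fixing_function :: "'a pair_pre_digraph \<Rightarrow> ('a \<Rightarrow> real) \<Rightarrow> bool" where
  "fixing_function G g \<longleftrightarrow>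
     (\<forall>x\<in>pverts G. 0 \<le> g x \<and> g x \<le> 1) \<and>
     (\<forall>(u, v)\<in>V_a G. (\<Sum>x\<in>fixing_set G u v. g x) \<ge> 1)"

definition fun_weight :: "'a pair_pre_digraph \<Rightarrow> ('a \<Rightarrow> real) \<Rightarrow> real" where
  "fun_weight G g = (\<Sum>x\<in>pverts G. g x)"

text \<open>
  \<open>LEAST\<close> is the minimum of the set of weights; it is attained for every finite
  simple graph, see \<open>fractional_fixing_number_attained\<close> below.
\<close>

definition fractional_fixing_number :: "'a pair_pre_digraph \<Rightarrow> real" where
  "fractional_fixing_number G = (LEAST w. \<exists>g. fixing_function G g \<and> w = fun_weight G g)"

lemma fixing_function_one:
  assumes "finite (pverts G)"
  shows "fixing_function G (\<lambda>_. 1)"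
proof -
  have "1 \<le> real (card (fixing_set G u v))" if uv: "(u, v) \<in> V_a G" for u v
  proof -
    have "id \<in> aut_stabilizer G u"
      by (simp add: aut_stabilizer_def automorphisms_def permutes_id)
    then have "v \<in> stab_orbit G u v"
      unfolding stab_orbit_def by (intro CollectI exI[of _ id]) simp
    moreover have "stab_orbit G u u \<subseteq> {u}"
      by (auto simp: stab_orbit_def aut_stabilizer_def)
    ultimately have "u \<in> fixing_set G u v"
      using uv by (auto simp: fixing_set_def V_a_def)
    moreover have "finite (fixing_set G u v)"
      using assms by (simp add: fixing_set_def)
    ultimately have "card (fixing_set G u v) \<noteq> 0"
      by auto
    then show ?thesis
      by linarith
  qed
  then show ?thesis
    by (auto simp: fixing_function_def Suc_le_eq)
qed

lemma fractional_fixing_number_attained: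
  assumes "finite (pverts G)"
  shows "\<exists>g. fixing_function G g \<and> fractional_fixing_number G = fun_weight G g"
    and "fixing_function G h \<Longrightarrow> fractional_fixing_number G \<le> fun_weight G h"
proof -
  define B :: "'a \<Rightarrow> real set" where "B = (\<lambda>x. if x \<in> pverts G then {0..1} else {0})"
  define C where "C = (\<Inter>(u, v)\<in>V_a G. {g :: 'a \<Rightarrow> real. 1 \<le> (\<Sum>x\<in>fixing_set G u v. g x)})"
  define r where "r g x = (if x \<in> pverts G then g x else 0)" for g :: "'a \<Rightarrow> real" and x
  have cont: "continuous_on S (\<lambda>g. \<Sum>x\<in>A. g x)" for A and S :: "('a \<Rightarrow> real) set"
    by (rule continuous_on_sum) (rule continuous_on_subset[OF continuous_on_product_coordinates subset_UNIV])
  have "compactin (product_topology (\<lambda>_. euclidean) UNIV) (Pi\<^sub>E UNIV B)"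
    by (subst compactin_PiE) (auto simp: B_def)
  then have "compact (Pi\<^sub>E UNIV B)"
    by (simp add: euclidean_product_topology)
  moreover have "closed C"
    unfolding C_def case_prod_beta
    by (intro closed_INT ballI closed_Collect_le cont continuous_on_const)
  ultimately have comp: "compact (Pi\<^sub>E UNIV B \<inter> C)"
    by (rule compact_Int_closed)
  have fix_mem: "r g \<in> Pi\<^sub>E UNIV B \<inter> C" if "fixing_function G g" for g
  proof -
    have "(\<Sum>x\<in>fixing_set G u v. r g x) = (\<Sum>x\<in>fixing_set G u v. g x)" for u v
      by (rule sum.cong) (auto simp: r_def fixing_set_def)
    then show ?thesis
      using that by (auto simp: fixing_function_def C_def B_def r_def PiE_iff)
  qed
  have mem_fix: "fixing_function G g" if "g \<in> Pi\<^sub>E UNIV B \<inter> C" for g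
    using that by (auto simp: fixing_function_def C_def B_def PiE_iff split: if_splits)
  have weight: "fun_weight G (r g) = fun_weight G g" for g
    by (simp add: fun_weight_def r_def)
  have "Pi\<^sub>E UNIV B \<inter> C \<noteq> {}"
    using fix_mem[OF fixing_function_one[OF assms]] by blast
  from continuous_attains_inf[OF comp this cont, of "pverts G"]
  obtain g where g: "g \<in> Pi\<^sub>E UNIV B \<inter> C"
    and min: "\<forall>h\<in>Pi\<^sub>E UNIV B \<inter> C. fun_weight G g \<le> fun_weight G h"
    unfolding fun_weight_def by blast
  have least: "fun_weight G g \<le> fun_weight G h" if "fixing_function G h" for h
    using min fix_mem[OF that] weight[of h] by (metis (no_types))
  have eq: "fractional_fixing_number G = fun_weight G g"
    unfolding fractional_fixing_number_def
    by (rule Least_equality) (use mem_fix[OF g] least in auto)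
  show "\<exists>g. fixing_function G g \<and> fractional_fixing_number G = fun_weight G g"
    using eq mem_fix[OF g] by blast
  show "fixing_function G h \<Longrightarrow> fractional_fixing_number G \<le> fun_weight G h"
    using eq least by simp
qed

end

theory Submission
  imports Defs
begin

text \<open>
  Moving a pair of vertices by an automorphism \<open>\<pi>\<close> moves its fixing set by \<open>\<pi>\<close>
  (\<open>fixing_set_equivariant\<close>), so a fixing function \<open>g\<close> satisfies not only the constraint
  \<open>1 \<le> (\<Sum>x\<in>F. g x)\<close> of a fixed pair with fixing set \<open>F\<close>, but also all its translates
  \<open>1 \<le> (\<Sum>x\<in>F. g (\<pi> x))\<close>. When the automorphism group is transitive, the average of
  \<open>g (\<pi> x)\<close> over all \<open>\<pi>\<close> does not depend on \<open>x\<close> and is therefore the mean value of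
  \<open>g\<close> over the vertices (\<open>sum_automorphisms_transitive\<close>). Averaging the translated constraints
  thus gives \<open>1 \<le> card F * (|g| / n)\<close>, where \<open>n\<close> is the number of vertices and \<open>|g|\<close>
  the weight of \<open>g\<close>. For a pair with the smallest fixing set this is the lower bound
  \<open>n / f \<le> |g|\<close>. The constant function \<open>1 / f\<close>, which is a fixing function because
  every fixing set has at least \<open>f\<close> elements, attains it.
\<close>

lemma automorphisms_permutes: "\<pi> \<in> automorphisms G \<Longrightarrow> \<pi> permutes pverts G"
  by (simp add: automorphisms_def)

lemma automorphisms_arcs_iff:
  assumes "\<pi> \<in> automorphisms G" "u \<in> pverts G" "v \<in> pverts G"
  shows "(\<pi> u, \<pi> v) \<in> parcs G \<longleftrightarrow> (u, v) \<in> parcs G"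
  using assms unfolding automorphisms_def by blast

lemma id_in_automorphisms: "id \<in> automorphisms G"
  by (simp add: automorphisms_def permutes_id)

lemma automorphisms_comp:
  assumes "\<sigma> \<in> automorphisms G" "\<pi> \<in> automorphisms G"
  shows "\<sigma> \<circ> \<pi> \<in> automorphisms G"
  unfolding automorphisms_def
  by (simp add: permutes_compose automorphisms_permutes assms automorphisms_arcs_iff
      permutes_in_image[OF automorphisms_permutes[OF assms(2)]])

lemma automorphisms_inv:
  assumes "\<pi> \<in> automorphisms G"
  shows "inv \<pi> \<in> automorphisms G"
proof -
  have p: "\<pi> permutes pverts G"
    using assms by (rule automorphisms_permutes)
  have "(u, v) \<in> parcs G \<longleftrightarrow> (inv \<pi> u, inv \<pi> v) \<in> parcs G"
    if "u \<in> pverts G" "v \<in> pverts G" for u v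
  proof -
    have "inv \<pi> u \<in> pverts G" "inv \<pi> v \<in> pverts G"
      using that permutes_in_image[OF permutes_inv[OF p]] by simp_all
    from automorphisms_arcs_iff[OF assms this] show ?thesis
      by (simp add: permutes_inverses[OF p])
  qed
  then show ?thesis
    using permutes_inv[OF p] unfolding automorphisms_def by blast
qed

lemma finite_automorphisms: "finite (pverts G) \<Longrightarrow> finite (automorphisms G)"
  by (rule finite_subset[OF _ finite_permutations]) (auto simp: automorphisms_def)

lemma bij_betw_automorphisms_comp:
  assumes "\<sigma> \<in> automorphisms G"
  shows "bij_betw (\<lambda>\<pi>. \<pi> \<circ> \<sigma>) (automorphisms G) (automorphisms G)"
proof -
  have p: "\<sigma> permutes pverts G"
    using assms by (rule automorphisms_permutes)
  show ?thesis
  proof (rule bij_betw_byWitness[where f' = "\<lambda>\<pi>. \<pi> \<circ> inv \<sigma>"])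
    show "(\<lambda>\<pi>. \<pi> \<circ> \<sigma>) ` automorphisms G \<subseteq> automorphisms G"
      by (rule image_subsetI) (rule automorphisms_comp[OF _ assms])
    show "(\<lambda>\<pi>. \<pi> \<circ> inv \<sigma>) ` automorphisms G \<subseteq> automorphisms G"
      by (rule image_subsetI) (rule automorphisms_comp[OF _ automorphisms_inv[OF assms]])
  qed (simp_all add: comp_assoc permutes_inv_o[OF p])
qed

lemma aut_orbit_automorphism:
  assumes "\<pi> \<in> automorphisms G"
  shows "aut_orbit G (\<pi> u) = aut_orbit G u"
proof -
  have "aut_orbit G (\<pi> u) = (\<lambda>\<sigma>. \<sigma> u) ` (\<lambda>\<sigma>. \<sigma> \<circ> \<pi>) ` automorphisms G"
    by (simp add: aut_orbit_def Setcompr_eq_image image_image)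
  also have "(\<lambda>\<sigma>. \<sigma> \<circ> \<pi>) ` automorphisms G = automorphisms G"
    using bij_betw_automorphisms_comp[OF assms] by (rule bij_betw_imp_surj_on)
  finally show ?thesis
    by (simp add: aut_orbit_def Setcompr_eq_image)
qed

text \<open>Conjugation by \<open>\<pi>\<close> carries the stabilizer of \<open>x\<close> into that of \<open>\<pi> x\<close>.\<close>

lemma image_stab_orbit_subset:
  assumes "\<pi> \<in> automorphisms G"
  shows "\<pi> ` stab_orbit G x u \<subseteq> stab_orbit G (\<pi> x) (\<pi> u)"
proof
  fix w assume "w \<in> \<pi> ` stab_orbit G x u"
  then obtain \<sigma> where s: "\<sigma> \<in> automorphisms G" "\<sigma> x = x" and w: "w = \<pi> (\<sigma> u)"
    by (auto simp: stab_orbit_def aut_stabilizer_def)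
  have p: "inv \<pi> (\<pi> y) = y" for y
    using permutes_inverses(2)[OF automorphisms_permutes[OF assms]] .
  have "\<pi> \<circ> \<sigma> \<circ> inv \<pi> \<in> aut_stabilizer G (\<pi> x)"
    using automorphisms_comp[OF automorphisms_comp[OF assms s(1)] automorphisms_inv[OF assms]]
    by (simp add: aut_stabilizer_def p s(2))
  moreover have "w = (\<pi> \<circ> \<sigma> \<circ> inv \<pi>) (\<pi> u)"
    by (simp add: w p)
  ultimately show "w \<in> stab_orbit G (\<pi> x) (\<pi> u)"
    unfolding stab_orbit_def by (intro CollectI exI conjI)
qed

lemma stab_orbit_equivariant:
  assumes "\<pi> \<in> automorphisms G"
  shows "stab_orbit G (\<pi> x) (\<pi> u) = \<pi> ` stab_orbit G x u"
proof
  have p: "\<pi> permutes pverts G"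
    using assms by (rule automorphisms_permutes)
  \<comment> \<open>The reverse inclusion is the previous lemma for the inverse automorphism.\<close>
  have "inv \<pi> ` stab_orbit G (\<pi> x) (\<pi> u) \<subseteq> stab_orbit G x u"
    using image_stab_orbit_subset[OF automorphisms_inv[OF assms], of "\<pi> x" "\<pi> u"]
    by (simp add: permutes_inverses[OF p])
  then have "\<pi> ` inv \<pi> ` stab_orbit G (\<pi> x) (\<pi> u) \<subseteq> \<pi> ` stab_orbit G x u"
    by (rule image_mono)
  then show "stab_orbit G (\<pi> x) (\<pi> u) \<subseteq> \<pi> ` stab_orbit G x u"
    by (simp add: image_image permutes_inverses[OF p])
qed (rule image_stab_orbit_subset[OF assms])

lemma fixing_set_equivariant:
  assumes "\<pi> \<in> automorphisms G"
  shows "fixing_set G (\<pi> u) (\<pi> v) = \<pi> ` fixing_set G u v"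
proof -
  have p: "\<pi> permutes pverts G"
    using assms by (rule automorphisms_permutes)
  have mem: "\<pi> x \<in> fixing_set G (\<pi> u) (\<pi> v) \<longleftrightarrow> x \<in> fixing_set G u v" for x
    by (simp add: fixing_set_def permutes_in_image[OF p] stab_orbit_equivariant[OF assms]
        inj_image_eq_iff[OF permutes_inj[OF p]])
  show ?thesis
  proof (intro equalityI subsetI)
    fix y assume "y \<in> fixing_set G (\<pi> u) (\<pi> v)"
    then have "inv \<pi> y \<in> fixing_set G u v"
      using mem[of "inv \<pi> y"] by (simp add: permutes_inverses[OF p])
    then show "y \<in> \<pi> ` fixing_set G u v"
      by (rule rev_image_eqI) (simp add: permutes_inverses[OF p])
  qed (auto simp: mem)
qed

lemma V_a_automorphism:
  assumes "\<pi> \<in> automorphisms G" "(u, v) \<in> V_a G"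
  shows "(\<pi> u, \<pi> v) \<in> V_a G"
  using assms(2) permutes_in_image[OF automorphisms_permutes[OF assms(1)]]
    inj_eq[OF permutes_inj[OF automorphisms_permutes[OF assms(1)]]]
  by (simp add: V_a_def aut_orbit_automorphism[OF assms(1)])

lemma V_a_nonempty:
  assumes "card (pverts G) \<ge> 2" and "vertex_transitive G"
  shows "V_a G \<noteq> {}"
proof -
  obtain u v where uv: "u \<in> pverts G" "v \<in> pverts G" "u \<noteq> v"
    using assms(1) card_le_Suc0_iff_eq[of "pverts G"] card.infinite[of "pverts G"] by fastforce
  then obtain \<pi> where \<pi>: "\<pi> \<in> automorphisms G" "\<pi> u = v"
    using assms(2) unfolding vertex_transitive_def by blast
  have "aut_orbit G u = aut_orbit G v"
    using aut_orbit_automorphism[OF \<pi>(1), of u] by (simp add: \<pi>(2))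
  then show ?thesis
    using uv by (auto simp: V_a_def)
qed

text \<open>
  By transitivity the sum over the group does not depend on \<open>x\<close>: replacing \<open>x\<close> by
  \<open>\<sigma> x\<close> only reindexes it. Its value comes from summing over all \<open>x\<close> and exchanging
  the sums, each automorphism contributing the full weight. The identity is stated without division.
\<close>

lemma sum_automorphisms_transitive:
  assumes "vertex_transitive G" and x: "x \<in> pverts G"
  shows "real (card (pverts G)) * (\<Sum>\<pi>\<in>automorphisms G. g (\<pi> x))
    = real (card (automorphisms G)) * fun_weight G g"
proof -
  have const: "(\<Sum>\<pi>\<in>automorphisms G. g (\<pi> y)) = (\<Sum>\<pi>\<in>automorphisms G. g (\<pi> x))"
    if y: "y \<in> pverts G" for y
  proof -
    obtain \<sigma> where s: "\<sigma> \<in> automorphisms G" "\<sigma> x = y"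
      using assms y unfolding vertex_transitive_def by blast
    show ?thesis
      using sum.reindex_bij_betw[OF bij_betw_automorphisms_comp[OF s(1)], of "\<lambda>\<pi>. g (\<pi> x)"]
      by (simp add: s(2))
  qed
  have "real (card (pverts G)) * (\<Sum>\<pi>\<in>automorphisms G. g (\<pi> x))
      = (\<Sum>y\<in>pverts G. \<Sum>\<pi>\<in>automorphisms G. g (\<pi> y))"
    by (simp add: const)
  also have "\<dots> = (\<Sum>\<pi>\<in>automorphisms G. \<Sum>y\<in>pverts G. g (\<pi> y))"
    by (rule sum.swap)
  also have "\<dots> = (\<Sum>\<pi>\<in>automorphisms G. fun_weight G g)"
    unfolding fun_weight_def
    by (intro sum.cong refl sum.reindex_bij_betw permutes_imp_bij automorphisms_permutes)
  finally show ?thesis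
    by simp
qed

lemma fixing_function_weight_lower_bound:
  assumes fin: "finite (pverts G)" and vt: "vertex_transitive G"
    and g: "fixing_function G g" and uv: "(u, v) \<in> V_a G"
  shows "real (card (pverts G)) \<le> real (card (fixing_set G u v)) * fun_weight G g"
proof -
  let ?A = "automorphisms G" and ?F = "fixing_set G u v"
  have "1 \<le> (\<Sum>x\<in>?F. g (\<pi> x))" if "\<pi> \<in> ?A" for \<pi>
  proof -
    have "1 \<le> (\<Sum>x\<in>fixing_set G (\<pi> u) (\<pi> v). g x)"
      using g V_a_automorphism[OF that uv] by (auto simp: fixing_function_def)
    also have "\<dots> = (\<Sum>x\<in>?F. g (\<pi> x))"
      unfolding fixing_set_equivariant[OF that]
      by (subst sum.reindex)
        (simp_all add: inj_on_subset[OF permutes_inj[OF automorphisms_permutes[OF that]]])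
    finally show ?thesis .
  qed
  then have "(\<Sum>\<pi>\<in>?A. 1) \<le> (\<Sum>\<pi>\<in>?A. \<Sum>x\<in>?F. g (\<pi> x))"
    by (intro sum_mono) simp
  also have "\<dots> = (\<Sum>x\<in>?F. \<Sum>\<pi>\<in>?A. g (\<pi> x))"
    by (rule sum.swap)
  finally have "real (card (pverts G)) * real (card ?A)
      \<le> real (card (pverts G)) * (\<Sum>x\<in>?F. \<Sum>\<pi>\<in>?A. g (\<pi> x))"
    by (intro mult_left_mono) simp_all
  also have "\<dots> = (\<Sum>x\<in>?F. real (card ?A) * fun_weight G g)"
    unfolding sum_distrib_left
    by (intro sum.cong refl)
      (simp add: fixing_set_def sum_automorphisms_transitive[OF vt] flip: sum_distrib_left)
  also have "\<dots> = (real (card ?F) * fun_weight G g) * real (card ?A)"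
    by simp
  finally have "real (card (pverts G)) * real (card ?A)
      \<le> (real (card ?F) * fun_weight G g) * real (card ?A)" .
  moreover have "card ?A > 0"
    using finite_automorphisms[OF fin] id_in_automorphisms by (auto simp: card_gt_0_iff)
  ultimately show ?thesis
    by simp
qed

text \<open>The constraint of the all-one fixing function at \<open>(u, v)\<close> says exactly this.\<close>

lemma card_fixing_set_pos:
  assumes "finite (pverts G)" and "(u, v) \<in> V_a G"
  shows "card (fixing_set G u v) > 0"
  using fixing_function_one[OF assms(1)] assms(2) by (auto simp: fixing_function_def)

lemma finite_card_fixing_sets:
  assumes "finite (pverts G)"
  shows "finite {card (fixing_set G u v) | u v. (u, v) \<in> V_a G}"
proof (rule finite_subset)
  show "{card (fixing_set G u v) | u v. (u, v) \<in> V_a G} \<subseteq> {..card (pverts G)}"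
    using assms by (auto simp: fixing_set_def intro: card_mono)
qed simp

lemma min_fixing_card_le:
  assumes "finite (pverts G)" and "(u, v) \<in> V_a G"
  shows "min_fixing_card G \<le> card (fixing_set G u v)"
  unfolding min_fixing_card_def
  by (rule Min_le[OF finite_card_fixing_sets[OF assms(1)]]) (use assms(2) in blast)

lemma min_fixing_card_attained:
  assumes "finite (pverts G)" and "V_a G \<noteq> {}"
  obtains u v where "(u, v) \<in> V_a G" "min_fixing_card G = card (fixing_set G u v)"
proof -
  have "{card (fixing_set G u v) | u v. (u, v) \<in> V_a G} \<noteq> {}"
    using assms(2) by auto
  from Min_in[OF finite_card_fixing_sets[OF assms(1)] this] show ?thesis
    using that unfolding min_fixing_card_def by blast
qed

lemma fixing_function_const:
  assumes fin: "finite (pverts G)" and pos: "min_fixing_card G > 0"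
  shows "fixing_function G (\<lambda>_. 1 / real (min_fixing_card G))"
  using pos min_fixing_card_le[OF fin] by (auto simp: fixing_function_def)

theorem theorem4p1:
  fixes G :: "'a pair_pre_digraph"
  assumes "pair_graph G"
    and "card (pverts G) \<ge> 2"
    and "vertex_transitive G"
  shows "fractional_fixing_number G = real (card (pverts G)) / real (min_fixing_card G)"
proof -
  have fin: "finite (pverts G)"
    using assms(2) by (metis card.infinite not_numeral_le_zero)
  obtain u v where uv: "(u, v) \<in> V_a G" and f: "min_fixing_card G = card (fixing_set G u v)"
    using min_fixing_card_attained[OF fin V_a_nonempty[OF assms(2,3)]] .
  have pos: "min_fixing_card G > 0"
    using card_fixing_set_pos[OF fin uv] f by simp
  show ?thesis
  proof (rule antisym)
    show "fractional_fixing_number G \<le> real (card (pverts G)) / real (min_fixing_card G)"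
      using fractional_fixing_number_attained(2)[OF fin fixing_function_const[OF fin pos]]
      by (simp add: fun_weight_def)
    obtain g where g: "fixing_function G g" "fractional_fixing_number G = fun_weight G g"
      using fractional_fixing_number_attained(1)[OF fin] by blast
    then show "real (card (pverts G)) / real (min_fixing_card G) \<le> fractional_fixing_number G"
      using fixing_function_weight_lower_bound[OF fin assms(3) g(1) uv] pos
      by (simp add: f divide_simps mult.commute)
  qed
qed

end
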